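(* Let $(L,\vee,\wedge,{}',0,1)$ be a non-trivial complete orthomodular lattice, let $(T,R)$ be a time frame with reflexive $R$, let $P,F,H,G\colon L^T\to L^T$ denote the tense operators induced by $(T,R)$, let $A,A_1,A_2\in\{P,F\}$, $B,B_1,B_2\in\{H,G\}$ and $p,q\in L^T$. Then the following hold: (i) $p\leq q\rightarrow A_1\big(A_2(p)\odot q\big)$; (ii) $B(p\odot q)\leq A(p)\odot q$; (iii) $B(p)\leq q\rightarrow A(p\odot q)$; (iv) $B_1\big(B_2(p)\odot q\big)\leq p\odot q$; (v) $p\rightarrow q\leq A_1\big(p\rightarrow A_2(q)\big)$; (vi) $B(p\rightarrow q)\odot p\leq A(q)$; (vii) $p\rightarrow B(q)\leq A(p\rightarrow q)$; (viii) $B_1\big(p\rightarrow B_2(q)\big)\odot p\leq q$.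
   Context: An orthomodular lattice is an algebra $(L,\vee,\wedge,{}',0,1)$ such that $(L,\vee,\wedge,0,1)$ is a bounded lattice, $'$ is an antitone involution ($x\leq y$ implies $y'\leq x'$, and $x''=x$), $x\vee x'=1$ and $x\wedge x'=0$ for all $x\in L$, and the orthomodular law holds: if $x\leq y$ then $y=x\vee(y\wedge x')$. It is complete if its underlying lattice is complete; non-trivial means that $L$ has more than one element. On $L$ one defines $x\odot y:=(x\vee y')\wedge y$ and $x\rightarrow y:=(y\wedge x)\vee x'$. A time frame is a pair $(T,R)$ consisting of a non-empty set $T$ and a non-empty binary relation $R\subseteq T\times T$; $s\mathrel R t$ means $(s,t)\in R$. $L^T$ is the set of all functions $T\to L$, with order and operations (including $\odot$ and $\rightarrow$) defined pointwise. The tense operators $P,F,H,G\colon L^T\to L^T$ induced by $(T,R)$ are defined, for $q\in L^T$ and $s\in T$, by $P(q)(s):=\bigvee\{q(t)\mid t\mathrel R s\}$, $F(q)(s):=\bigvee\{q(t)\mid s\mathrel R t\}$, $H(q)(s):=\bigwedge\{q(t)\mid t\mathrel R s\}$, $G(q)(s):=\bigwedge\{q(t)\mid s\mathrel R t\}$. *)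

theory Defs
  imports "HOL-Library.Complemented_Lattices"
begin

(* The sort {lattice, uminus} is chosen so that the same two constants serve on the
   orthomodular lattice 'a and on the function space 't => 'a, whose library instances
   of sup, inf and uminus are pointwise; see the two lemmas below. *)

definition sasaki_prod :: "'a::{lattice, uminus} \<Rightarrow> 'a \<Rightarrow> 'a"  (infixl "\<odot>" 70)
  where "x \<odot> y = inf (sup x (- y)) y"

definition sasaki_imp :: "'a::{lattice, uminus} \<Rightarrow> 'a \<Rightarrow> 'a"  (infixr "\<rightarrow>" 60)
  where "x \<rightarrow> y = sup (inf y x) (- x)"

lemma sasaki_prod_apply: "(p \<odot> q) s = p s \<odot> q s"
  by (simp add: sasaki_prod_def)

lemma sasaki_imp_apply: "(p \<rightarrow> q) s = p s \<rightarrow> q s"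
  by (simp add: sasaki_imp_def)

(* The time set T is the (automatically non-empty) type 't; (s, t) \<in> R means s R t. *)

definition tense_P :: "('t \<times> 't) set \<Rightarrow> ('t \<Rightarrow> 'a::complete_lattice) \<Rightarrow> 't \<Rightarrow> 'a"
  where "tense_P R q s = Sup {q t | t. (t, s) \<in> R}"

definition tense_F :: "('t \<times> 't) set \<Rightarrow> ('t \<Rightarrow> 'a::complete_lattice) \<Rightarrow> 't \<Rightarrow> 'a"
  where "tense_F R q s = Sup {q t | t. (s, t) \<in> R}"

definition tense_H :: "('t \<times> 't) set \<Rightarrow> ('t \<Rightarrow> 'a::complete_lattice) \<Rightarrow> 't \<Rightarrow> 'a"
  where "tense_H R q s = Inf {q t | t. (t, s) \<in> R}"

definition tense_G :: "('t \<times> 't) set \<Rightarrow> ('t \<Rightarrow> 'a::complete_lattice) \<Rightarrow> 't \<Rightarrow> 'a"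
  where "tense_G R q s = Inf {q t | t. (s, t) \<in> R}"

end

theory Submission
  imports Defs
begin

text \<open>Two facts combine. In an orthomodular lattice the map
  \<open>x \<mapsto> x \<odot> y\<close> is left adjoint to
  \<open>z \<mapsto> y \<rightarrow> z\<close>; this enters through monotonicity of both maps, the
  unit \<open>le_sasaki_imp_sasaki_prod\<close> and the counit
  \<open>sasaki_imp_sasaki_prod_le\<close>. Reflexivity of \<open>R\<close> makes
  \<open>tense_P\<close>, \<open>tense_F\<close> inflationary and \<open>tense_H\<close>,
  \<open>tense_G\<close> deflationary. Each of the eight inequalities is a chain of such
  steps.\<close>

lemma sasaki_prod_mono: "x \<le> y \<Longrightarrow> x \<odot> z \<le> y \<odot> z"
  for x y z :: "'a::{lattice, uminus}"
  unfolding sasaki_prod_def by (rule inf_mono[OF sup_mono]) simp_all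

text \<open>The complemented argument \<open>z\<close> stays fixed, so this is a pure lattice fact
  and applies directly on the function space.\<close>

lemma sasaki_imp_mono: "x \<le> y \<Longrightarrow> z \<rightarrow> x \<le> z \<rightarrow> y"
  for x y z :: "'a::{lattice, uminus}"
  unfolding sasaki_imp_def by (rule sup_mono[OF inf_mono]) simp_all

text \<open>Unit of the adjunction: the orthomodular law for \<open>- y \<le> sup x (- y)\<close>
  collapses the right-hand side to \<open>sup x (- y)\<close>.\<close>

lemma le_sasaki_imp_sasaki_prod: "x \<le> y \<rightarrow> (x \<odot> y)"
  for x y :: "'a::orthomodular_lattice"
proof -
  have "sup (- y) (inf (- (- y)) (sup x (- y))) = sup x (- y)"
    by (rule orthomodular) simp
  then have "y \<rightarrow> (x \<odot> y) = sup x (- y)"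
    by (simp add: sasaki_imp_def sasaki_prod_def ac_simps)
  then show ?thesis by simp
qed

text \<open>Counit of the adjunction: the left-hand side is exactly \<open>inf y x\<close>, by the
  De Morgan dual of the orthomodular law.\<close>

lemma sasaki_imp_sasaki_prod_le: "(x \<rightarrow> y) \<odot> x \<le> y"
  for x y :: "'a::orthomodular_lattice"
proof -
  \<comment> \<open>The law is applied to \<open>- x \<le> - inf y x\<close>; complementing both
    sides then gives the dual form.\<close>
  have "sup (- x) (inf (- (- x)) (- inf y x)) = - inf y x"
    by (rule orthomodular) simp
  then have "- sup (- x) (inf (- (- x)) (- inf y x)) = inf y x"
    by simp
  then have "(x \<rightarrow> y) \<odot> x = inf y x"
    by (simp add: sasaki_imp_def sasaki_prod_def ac_simps)
  then show ?thesis by simp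
qed

text \<open>By reflexivity \<open>q s\<close> is itself one of the values whose join is taken at
  \<open>s\<close>.\<close>

lemma le_tense_P: "refl R \<Longrightarrow> q \<le> tense_P R q"
  by (auto simp: le_fun_def tense_P_def refl_on_def intro!: Sup_upper)

lemma le_tense_F: "refl R \<Longrightarrow> q \<le> tense_F R q"
  by (auto simp: le_fun_def tense_F_def refl_on_def intro!: Sup_upper)

lemma tense_H_le: "refl R \<Longrightarrow> tense_H R q \<le> q"
  by (auto simp: le_fun_def tense_H_def refl_on_def intro!: Inf_lower)

lemma tense_G_le: "refl R \<Longrightarrow> tense_G R q \<le> q"
  by (auto simp: le_fun_def tense_G_def refl_on_def intro!: Inf_lower)

theorem theorem4p4:
  fixes R :: "('t \<times> 't) set"
    and A A\<^sub>1 A\<^sub>2 B B\<^sub>1 B\<^sub>2 :: "('t \<Rightarrow> 'a::complete_orthomodular_lattice) \<Rightarrow> ('t \<Rightarrow> 'a)"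
    and p q :: "'t \<Rightarrow> 'a"
  assumes nontrivial: "\<exists>x y :: 'a. x \<noteq> y"
    and time_frame: "R \<noteq> {}"
    and reflexive: "refl R"
    and A: "A \<in> {tense_P R, tense_F R}"
    and A\<^sub>1: "A\<^sub>1 \<in> {tense_P R, tense_F R}"
    and A\<^sub>2: "A\<^sub>2 \<in> {tense_P R, tense_F R}"
    and B: "B \<in> {tense_H R, tense_G R}"
    and B\<^sub>1: "B\<^sub>1 \<in> {tense_H R, tense_G R}"
    and B\<^sub>2: "B\<^sub>2 \<in> {tense_H R, tense_G R}"
  shows "p \<le> q \<rightarrow> A\<^sub>1 (A\<^sub>2 p \<odot> q)
    \<and> B (p \<odot> q) \<le> A p \<odot> q
    \<and> B p \<le> q \<rightarrow> A (p \<odot> q)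
    \<and> B\<^sub>1 (B\<^sub>2 p \<odot> q) \<le> p \<odot> q
    \<and> p \<rightarrow> q \<le> A\<^sub>1 (p \<rightarrow> A\<^sub>2 q)
    \<and> B (p \<rightarrow> q) \<odot> p \<le> A q
    \<and> p \<rightarrow> B q \<le> A (p \<rightarrow> q)
    \<and> B\<^sub>1 (p \<rightarrow> B\<^sub>2 q) \<odot> p \<le> q"
proof -
  have upper: "r \<le> C r" if "C \<in> {tense_P R, tense_F R}" for C r
    using that le_tense_P[OF reflexive] le_tense_F[OF reflexive] by auto
  have lower: "C r \<le> r" if "C \<in> {tense_H R, tense_G R}" for C r
    using that tense_H_le[OF reflexive] tense_G_le[OF reflexive] by auto
  \<comment> \<open>Unit and counit pass to functions pointwise. The variable \<open>r\<close> is
    left free because the chains also use them at \<open>A\<^sub>2 p\<close> and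
    \<open>B\<^sub>2 q\<close>.\<close>
  have unit: "r \<le> q \<rightarrow> (r \<odot> q)" for r
    by (simp add: le_fun_def sasaki_imp_apply sasaki_prod_apply le_sasaki_imp_sasaki_prod)
  have counit: "(p \<rightarrow> r) \<odot> p \<le> r" for r
    by (simp add: le_fun_def sasaki_imp_apply sasaki_prod_apply sasaki_imp_sasaki_prod_le)
  show ?thesis
  proof (intro conjI)
    \<comment> \<open>The chain is \<open>p \<le> A\<^sub>2 p \<le> q \<rightarrow> (A\<^sub>2 p
      \<odot> q)\<close>, after which \<open>A\<^sub>1\<close> enlarges the conclusion of the
      implication.\<close>
    show "p \<le> q \<rightarrow> A\<^sub>1 (A\<^sub>2 p \<odot> q)"
      by (rule order_trans[OF order_trans[OF upper[OF A\<^sub>2] unit] sasaki_imp_mono[OF upper[OF A\<^sub>1]]])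
    show "B (p \<odot> q) \<le> A p \<odot> q"
      by (rule order_trans[OF lower[OF B] sasaki_prod_mono[OF upper[OF A]]])
    show "B p \<le> q \<rightarrow> A (p \<odot> q)"
      by (rule order_trans[OF order_trans[OF lower[OF B] unit] sasaki_imp_mono[OF upper[OF A]]])
    show "B\<^sub>1 (B\<^sub>2 p \<odot> q) \<le> p \<odot> q"
      by (rule order_trans[OF lower[OF B\<^sub>1] sasaki_prod_mono[OF lower[OF B\<^sub>2]]])
    show "p \<rightarrow> q \<le> A\<^sub>1 (p \<rightarrow> A\<^sub>2 q)"
      by (rule order_trans[OF sasaki_imp_mono[OF upper[OF A\<^sub>2]] upper[OF A\<^sub>1]])
    show "B (p \<rightarrow> q) \<odot> p \<le> A q"
      by (rule order_trans[OF order_trans[OF sasaki_prod_mono[OF lower[OF B]] counit] upper[OF A]])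
    show "p \<rightarrow> B q \<le> A (p \<rightarrow> q)"
      by (rule order_trans[OF sasaki_imp_mono[OF lower[OF B]] upper[OF A]])
    \<comment> \<open>Dropping \<open>B\<^sub>1\<close> leaves the counit at
      \<open>B\<^sub>2 q\<close>, which lies below \<open>q\<close>.\<close>
    show "B\<^sub>1 (p \<rightarrow> B\<^sub>2 q) \<odot> p \<le> q"
      by (rule order_trans[OF order_trans[OF sasaki_prod_mono[OF lower[OF B\<^sub>1]] counit] lower[OF B\<^sub>2]])
  qed
qed

end
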